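(* Let $D$ be the Dynkin diagram of the rank 3 hyperbolic Kac-Moody algebra $H'A_2^{(2)}$: vertices $1,2,3$, a single edge $1-2$, and a quadruple edge between $2$ and $3$ with arrow pointing toward $2$ (so $\langle\alpha_3,\alpha_2^\vee\rangle=-4$, $\langle\alpha_2,\alpha_3^\vee\rangle=-1$, and $\langle\alpha_1,\alpha_2^\vee\rangle=\langle\alpha_2,\alpha_1^\vee\rangle=-1$). The equivalence classes of nonempty paintings of $D$ are given by (a) $(1)\sim(2)$; (b) $(3)$. That is, $(1)$ and $(2)$ are equivalent, $(3)$ is not equivalent to them, and every nonempty painting is equivalent to one of these.
   Context: A painting of a Dynkin diagram is a choice of a subset of its vertices, called painted (a Vogan diagram with trivial diagram involution; painted vertices are the noncompact imaginary simple roots). The painting whose painted vertices are exactly $i_1,\dots,i_k$ is denoted $(i_1,\dots,i_k)$. For a painted vertex $i$, the operation $F\langle i\rangle$ is the change of positive system by reflection in the noncompact simple root $\alpha_i$: the color of $i$ and of all vertices not adjacent to $i$ is unchanged, and the color of an adjacent vertex $j$ is reversed exactly when the Cartan integer $\langle\alpha_j,\alpha_i^\vee\rangle$ is odd. Equivalence $\sim$ of paintings is the equivalence relation generated by all operations $F\langle i\rangle$ ($i$ painted) and by automorphisms of the Dynkin diagram. *)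

theory Defs
  imports Main
begin

text \<open>
  A Dynkin diagram is given by its vertex set \<open>V\<close> and its generalized Cartan matrix \<open>A\<close>, with
  Kac's convention \<open>A i j = \<langle>\<alpha>\<^sub>j, \<alpha>\<^sub>i\<^sup>\<or>\<rangle>\<close>: the row index is the coroot.
\<close>

definition generalized_cartan_matrix :: "'v set \<Rightarrow> ('v \<Rightarrow> 'v \<Rightarrow> int) \<Rightarrow> bool" where
  "generalized_cartan_matrix V A \<longleftrightarrow>
     finite V \<and> (\<forall>i\<in>V. A i i = 2) \<and>
     (\<forall>i\<in>V. \<forall>j\<in>V. i \<noteq> j \<longrightarrow> A i j \<le> 0) \<and>
     (\<forall>i\<in>V. \<forall>j\<in>V. A i j = 0 \<longleftrightarrow> A j i = 0)"

definition adjacent :: "('v \<Rightarrow> 'v \<Rightarrow> int) \<Rightarrow> 'v \<Rightarrow> 'v \<Rightarrow> bool" where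
  "adjacent A i j \<longleftrightarrow> i \<noteq> j \<and> A i j \<noteq> 0"

text \<open>A painting is identified with its set of painted vertices, so \<open>(i\<^sub>1,\<dots>,i\<^sub>k)\<close> is \<open>{i\<^sub>1,\<dots>,i\<^sub>k}\<close>.\<close>

definition paintings :: "'v set \<Rightarrow> 'v set set" where
  "paintings V = Pow V"

definition F_op :: "'v set \<Rightarrow> ('v \<Rightarrow> 'v \<Rightarrow> int) \<Rightarrow> 'v \<Rightarrow> 'v set \<Rightarrow> 'v set" where
  "F_op V A i S = {j \<in> V. if adjacent A i j \<and> odd (A i j) then j \<notin> S else j \<in> S}"

definition diagram_automorphism ::
  "'v set \<Rightarrow> ('v \<Rightarrow> 'v \<Rightarrow> int) \<Rightarrow> ('v \<Rightarrow> 'v) \<Rightarrow> bool" where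
  "diagram_automorphism V A \<sigma> \<longleftrightarrow>
     bij_betw \<sigma> V V \<and> (\<forall>i\<in>V. \<forall>j\<in>V. A (\<sigma> i) (\<sigma> j) = A i j)"

inductive painting_step ::
  "'v set \<Rightarrow> ('v \<Rightarrow> 'v \<Rightarrow> int) \<Rightarrow> 'v set \<Rightarrow> 'v set \<Rightarrow> bool" for V A where
  F: "S \<in> paintings V \<Longrightarrow> i \<in> S \<Longrightarrow> painting_step V A S (F_op V A i S)"
| aut: "S \<in> paintings V \<Longrightarrow> diagram_automorphism V A \<sigma> \<Longrightarrow> painting_step V A S (\<sigma> ` S)"

text \<open>\<open>equivclp\<close> is reflexive on the whole type, hence the restriction to paintings of \<open>V\<close>.\<close>

definition painting_equiv ::
  "'v set \<Rightarrow> ('v \<Rightarrow> 'v \<Rightarrow> int) \<Rightarrow> ('v set \<times> 'v set) set" where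
  "painting_equiv V A =
     {(S, T). S \<in> paintings V \<and> T \<in> paintings V \<and> equivclp (painting_step V A) S T}"

definition HA22_vertices :: "nat set" where
  "HA22_vertices = {1, 2, 3}"

text \<open>
  The diagram of \<open>H'A\<^sub>2\<^sup>(\<^sup>2\<^sup>)\<close>: a single edge between 1 and 2, and a quadruple edge between
  2 and 3 pointing toward 2, i.e. \<open>\<langle>\<alpha>\<^sub>3, \<alpha>\<^sub>2\<^sup>\<or>\<rangle> = -4\<close> and \<open>\<langle>\<alpha>\<^sub>2, \<alpha>\<^sub>3\<^sup>\<or>\<rangle> = -1\<close>.
\<close>

definition HA22_cartan :: "nat \<Rightarrow> nat \<Rightarrow> int" where
  "HA22_cartan i j =
     (if i = j then 2
      else if (i, j) \<in> {(1, 2), (2, 1), (3, 2)} then -1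
      else if (i, j) = (2, 3) then -4
      else 0)"

lemma generalized_cartan_matrix_HA22:
  "generalized_cartan_matrix HA22_vertices HA22_cartan"
  by (simp add: generalized_cartan_matrix_def HA22_vertices_def HA22_cartan_def)

abbreviation HA22_equiv :: "nat set \<Rightarrow> nat set \<Rightarrow> bool" (infix "\<sim>" 50) where
  "S \<sim> T \<equiv> (S, T) \<in> painting_equiv HA22_vertices HA22_cartan"

end

(* The Cartan integers <alpha_3, alpha_i^vee> with i = 1, 2 are 0 and -4, both even, so no operation
   changes the color of 3, and the arrow makes the diagram rigid; hence the color of 3 is an invariant.
   The remaining moves connect all nonempty paintings with the same color of 3. *)
theory Submission
  imports Defs
begin

lemma equiv_painting_equiv: "equiv (paintings V) (painting_equiv V A)"
proof (rule equivI)
  show "painting_equiv V A \<subseteq> paintings V \<times> paintings V"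
    by (auto simp: painting_equiv_def)
  show "refl_on (paintings V) (painting_equiv V A)"
    by (auto simp: refl_on_def painting_equiv_def)
  show "sym (painting_equiv V A)"
    by (auto simp: sym_def painting_equiv_def intro: equivclp_sym)
  show "trans (painting_equiv V A)"
    by (auto simp: trans_def painting_equiv_def intro: equivclp_trans)
qed

text \<open>Used to separate classes. The conclusion is symmetric in \<open>S\<close> and
  \<open>T\<close>, so it passes along a zigzag of steps whichever way each step is traversed;
  induction on the length of the zigzag does the rest.\<close>

lemma painting_equiv_invariant:
  assumes "(S, T) \<in> painting_equiv V A"
    and "\<And>S T. painting_step V A S T \<Longrightarrow> P S \<longleftrightarrow> P T"
  shows "P S \<longleftrightarrow> P T"
proof -
  have "equivclp (painting_step V A) S T"
    using assms(1) by (simp add: painting_equiv_def)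
  then show ?thesis
    by (induction rule: equivclp_induct) (use assms(2) in blast)+
qed

text \<open>\<open>F_op\<close> selects its result from \<open>V\<close>, so the target is
  automatically a painting. Naming the target \<open>T\<close> lets concrete moves be stated between
  explicit sets.\<close>

lemma painting_equiv_F_op:
  assumes "S \<in> paintings V" "i \<in> S" "F_op V A i S = T"
  shows "(S, T) \<in> painting_equiv V A"
  using assms painting_step.F[of S V i A]
  by (auto simp: painting_equiv_def paintings_def F_op_def)

text \<open>The value -4 occurs in the matrix only at position (2, 3), so an automorphism has to fix
  2 and 3; injectivity then leaves only 1 as the image of 1.\<close>

lemma HA22_automorphism_fixes:
  assumes "diagram_automorphism HA22_vertices HA22_cartan \<sigma>" and "i \<in> HA22_vertices"
  shows "\<sigma> i = i"
proof -
  have bij: "bij_betw \<sigma> {1, 2, 3} {1, 2, 3}"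
    and "HA22_cartan (\<sigma> 2) (\<sigma> 3) = HA22_cartan 2 3"
    using assms(1) by (simp_all add: diagram_automorphism_def HA22_vertices_def)
  then have "HA22_cartan (\<sigma> 2) (\<sigma> 3) = -4"
    by (simp add: HA22_cartan_def)
  then have "\<sigma> 2 = 2" "\<sigma> 3 = 3"
    by (auto simp: HA22_cartan_def split: if_splits)
  moreover have "\<sigma> 1 \<in> {1, 2, 3}" "\<sigma> 1 \<noteq> \<sigma> 2" "\<sigma> 1 \<noteq> \<sigma> 3"
    using bij by (auto simp: bij_betw_def)
  ultimately show ?thesis
    using assms(2) by (auto simp: HA22_vertices_def)
qed

lemma HA22_step_color_3:
  assumes "painting_step HA22_vertices HA22_cartan S T"
  shows "3 \<in> S \<longleftrightarrow> 3 \<in> T"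
  using assms
proof cases
  case (F i)
  then show ?thesis
    \<comment> \<open>When \<open>i\<close> is 3 itself, its color stays because
      \<open>adjacent\<close> excludes equal vertices; for \<open>i\<close> = 1, 2 the entry in
      column 3 is even.\<close>
    by (auto simp: F_op_def HA22_cartan_def adjacent_def HA22_vertices_def paintings_def)
next
  case (aut \<sigma>)
  \<comment> \<open>\<open>\<sigma>\<close> is known to be the identity only on the vertices, which
    suffices since \<open>S\<close> consists of vertices.\<close>
  then have "\<sigma> ` S = (\<lambda>i. i) ` S"
    by (intro image_cong) (auto simp: paintings_def intro: HA22_automorphism_fixes)
  then show ?thesis
    using aut by simp
qed

lemma HA22_F_op_equiv:
  assumes "S \<subseteq> {1, 2, 3}" "i \<in> S" "F_op HA22_vertices HA22_cartan i S = T"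
  shows "S \<sim> T"
  using assms by (intro painting_equiv_F_op) (auto simp: paintings_def HA22_vertices_def)

text \<open>By parity of the entries, reflection in 1 or 3 toggles only vertex 2, and reflection in
  2 toggles only vertex 1. The five moves form two paths: one through the three nonempty paintings
  without 3, one through the four paintings with 3.\<close>

lemma HA22_moves:
  "{1} \<sim> {1, 2}" "{2} \<sim> {1, 2}"
  "{3} \<sim> {2, 3}" "{2, 3} \<sim> {1, 2, 3}" "{1, 2, 3} \<sim> {1, 3}"
proof -
  note F_op_simps = F_op_def HA22_vertices_def HA22_cartan_def adjacent_def
  show "{1} \<sim> {1, 2}" by (rule HA22_F_op_equiv[of _ 1]) (auto simp: F_op_simps)
  show "{2} \<sim> {1, 2}" by (rule HA22_F_op_equiv[of _ 2]) (auto simp: F_op_simps)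
  show "{3} \<sim> {2, 3}" by (rule HA22_F_op_equiv[of _ 3]) (auto simp: F_op_simps)
  show "{2, 3} \<sim> {1, 2, 3}" by (rule HA22_F_op_equiv[of _ 2]) (auto simp: F_op_simps)
  show "{1, 2, 3} \<sim> {1, 3}" by (rule HA22_F_op_equiv[of _ 1]) (auto simp: F_op_simps)
qed

theorem proposition6p11:
  "{1} \<sim> {2} \<and> \<not> {3} \<sim> {1} \<and> \<not> {3} \<sim> {2} \<and>
   (\<forall>S \<in> paintings HA22_vertices. S \<noteq> {} \<longrightarrow> S \<sim> {1} \<or> S \<sim> {3}) \<and>
   (paintings HA22_vertices - {{}}) // painting_equiv HA22_vertices HA22_cartan =
     {painting_equiv HA22_vertices HA22_cartan `` {{1}},
      painting_equiv HA22_vertices HA22_cartan `` {{3}}}"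
proof -
  let ?R = "painting_equiv HA22_vertices HA22_cartan"
  let ?P = "paintings HA22_vertices"
  have eq: "equiv ?P ?R"
    by (rule equiv_painting_equiv)
  have refl: "S \<sim> S" if "S \<in> ?P" for S
    using eq that by (auto elim: equivE dest: refl_onD)
  have sym: "T \<sim> S" if "S \<sim> T" for S T
    using eq that by (auto elim: equivE dest: symD)
  have trans: "S \<sim> U" if "S \<sim> T" "T \<sim> U" for S T U
    using eq that by (auto elim: equivE dest: transD)
  have singleton: "{1} \<in> ?P" "{3} \<in> ?P"
    by (auto simp: paintings_def HA22_vertices_def)
  have "{1} \<sim> {2}"
    using HA22_moves(1,2) sym trans by blast
  moreover have "\<not> {3} \<sim> {1}" "\<not> {3} \<sim> {2}"
    using painting_equiv_invariant[where P = "\<lambda>S. 3 \<in> S", OF _ HA22_step_color_3]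
    by fastforce+
  moreover have classes: "S \<sim> {1} \<or> S \<sim> {3}" if "S \<in> ?P" "S \<noteq> {}" for S
  proof -
    have "{2} \<sim> {1}" "{1, 2} \<sim> {1}"
      using HA22_moves(1,2) sym trans by blast+
    moreover have "{2, 3} \<sim> {3}" "{1, 2, 3} \<sim> {3}" "{1, 3} \<sim> {3}"
      using HA22_moves(3-5) sym trans by blast+
    moreover have "S \<in> {{1}, {2}, {1, 2}, {3}, {2, 3}, {1, 2, 3}, {1, 3}}"
    proof -
      \<comment> \<open>Membership in \<open>Pow\<close> lets \<open>Pow_insert\<close> unfold into
        the explicit list of eight subsets, from which the empty one is then discarded.\<close>
      have "S \<in> Pow {1, 2, 3}"
        using that(1) by (simp add: paintings_def HA22_vertices_def)
      then show ?thesis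
        using that(2) by (simp only: Pow_insert Pow_empty) auto
    qed
    ultimately show ?thesis
      using refl singleton by blast
  qed
  moreover have "(?P - {{}}) // ?R = {?R `` {{1}}, ?R `` {{3}}}"
  proof
    show "(?P - {{}}) // ?R \<subseteq> {?R `` {{1}}, ?R `` {{3}}}"
      \<comment> \<open>The relation still lives on all paintings; only the representatives are
        restricted to nonempty ones. Each is related to \<open>{1}\<close> or \<open>{3}\<close>, so
        its class is one of the two.\<close>
      using classes equiv_class_eq[OF eq] by (fastforce simp: quotient_def)
    show "{?R `` {{1}}, ?R `` {{3}}} \<subseteq> (?P - {{}}) // ?R"
      using singleton by (auto intro!: quotientI)
  qed
  ultimately show ?thesis
    by blast
qed

end
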